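(* Let $l\in\mathbb N$ and let $\mathscr G=(W,F)$ be a one-circuit directed graph associated with a locally finite rooted directed tree $\mathscr T=(V,E)$ with root $\mathsf{root}$ and the circuit $\{w_1,\dots,w_{l+1}\}$, where $w_{l+1}:=\mathsf{root}$. Assume that $W$ is countably infinite and that $\mathscr G$ is leafless. Let $\boldsymbol\lambda=\{\lambda_w\}_{w\in W}$ be a system of positive numbers with $\inf_{w\in W}\lambda_w>0$ such that the weighted shift $S_{\boldsymbol\lambda,\mathscr G}$ is a bounded operator on $\ell^2(W)$. Then $S_{\boldsymbol\lambda,\mathscr G}$ is analytic if and only if for each $k=1,\dots,l+1$ the following series diverges: $$\sum_{v\in\mathsf{Chi}^{\langle k\rangle}_{\mathscr G}(\mathsf{root})}\left(\frac{\boldsymbol\lambda^{(k)}(v)}{\boldsymbol\lambda^{(k)}(w_k)}\right)^2+\sum_{m=1}^\infty\ \sum_{v\in\mathsf{Chi}^{\langle(l+1)m+k\rangle}_{\mathscr T}(\mathsf{root})}\left(\frac{\boldsymbol\lambda^{((l+1)m+k)}(v)}{\boldsymbol\lambda^{((l+1)m+k)}(w_k)}\right)^2 .$$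
   Context: $\mathbb N$ is the set of non-negative integers. A rooted directed tree $\mathscr T=(V,E)$, $E\subseteq V\times V$, is a directed graph that is connected, has no circuits, and has a vertex $\mathsf{root}$ such that no edge ends at $\mathsf{root}$ while every $v\in V\setminus\{\mathsf{root}\}$ has exactly one $u\in V$ with $(u,v)\in E$. It is locally finite if every vertex has finitely many children. One-circuit directed graph: given $l\in\mathbb N$, let $C_l=\emptyset$ if $l=0$ and $C_l=\{w_1,\dots,w_l\}$ ($l$ distinct new vertices not in $V$) otherwise. The one-circuit directed graph associated with $\mathscr T$ is $\mathscr G=(W,F)$ with $W=V\sqcup C_l$ and $F=E\cup\{(\mathsf{root},\mathsf{root})\}$ if $l=0$, $F=E\cup\{(\mathsf{root},w_1),(w_1,w_2),\dots,(w_{l-1},w_l),(w_l,\mathsf{root})\}$ if $l\geq1$. We put $w_{l+1}:=\mathsf{root}$. Every $w\in W$ has a unique parent in $\mathscr G$, i.e. a unique $\mathsf{par}(w)\in W$ with $(\mathsf{par}(w),w)\in F$; this defines $\mathsf{par}:W\to W$. Children: for a directed graph $\mathscr H=(X,D)$ and $U\subseteq X$, $\mathsf{Chi}_{\mathscr H}(U)=\bigcup_{u\in U}\{w\in X:(u,w)\in D\}$, $\mathsf{Chi}^{\langle0\rangle}_{\mathscr H}(U)=U$, $\mathsf{Chi}^{\langle n\rangle}_{\mathscr H}(U)=\mathsf{Chi}_{\mathscr H}(\mathsf{Chi}^{\langle n-1\rangle}_{\mathscr H}(U))$ for $n\geq1$, and $\mathsf{Chi}^{\langle n\rangle}_{\mathscr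 H}(u)=\mathsf{Chi}^{\langle n\rangle}_{\mathscr H}(\{u\})$. $\mathscr G$ is leafless if $\mathsf{Chi}_{\mathscr G}(\{w\})\neq\emptyset$ for every $w\in W$. Weighted shift: $(S_{\boldsymbol\lambda,\mathscr G}f)(w)=\lambda_w f(\mathsf{par}(w))$, $w\in W$, $f\in\ell^2(W)$. For $k\geq1$, $\boldsymbol\lambda^{(k)}(w)=\boldsymbol\lambda(w)\,\boldsymbol\lambda(\mathsf{par}(w))\cdots\boldsymbol\lambda(\mathsf{par}^{k-1}(w))$, where $\boldsymbol\lambda(w)=\lambda_w$. A bounded operator $T$ on $\mathcal H$ is analytic if $\bigcap_{n\geq0}T^n\mathcal H=\{0\}$. *)

theory Defs
  imports "HOL-Analysis.Analysis"
begin

text \<open>A directed graph is given by its vertex set \<open>X\<close> and edge set \<open>D \<subseteq> X \<times> X\<close>.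
  Connectedness ignores the direction of the edges, and circuits include loops.\<close>

definition rooted_directed_tree :: "'a set \<Rightarrow> ('a \<times> 'a) set \<Rightarrow> 'a \<Rightarrow> bool" where
  "rooted_directed_tree V E rt \<longleftrightarrow>
     E \<subseteq> V \<times> V \<and>
     (\<forall>u\<in>V. \<forall>v\<in>V. (u, v) \<in> (E \<union> E\<inverse>)\<^sup>*) \<and>
     acyclic E \<and>
     rt \<in> V \<and>
     (\<forall>u. (u, rt) \<notin> E) \<and>
     (\<forall>v\<in>V - {rt}. \<exists>!u. u \<in> V \<and> (u, v) \<in> E)"

definition Chi :: "'a set \<Rightarrow> ('a \<times> 'a) set \<Rightarrow> 'a set \<Rightarrow> 'a set" where
  "Chi X D U = (\<Union>u\<in>U. {w\<in>X. (u, w) \<in> D})"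

definition Chi_iter :: "'a set \<Rightarrow> ('a \<times> 'a) set \<Rightarrow> nat \<Rightarrow> 'a \<Rightarrow> 'a set" where
  "Chi_iter X D n u = (Chi X D ^^ n) {u}"

definition locally_finite :: "'a set \<Rightarrow> ('a \<times> 'a) set \<Rightarrow> bool" where
  "locally_finite X D \<longleftrightarrow> (\<forall>u\<in>X. finite (Chi X D {u}))"

definition leafless :: "'a set \<Rightarrow> ('a \<times> 'a) set \<Rightarrow> bool" where
  "leafless X D \<longleftrightarrow> (\<forall>u\<in>X. Chi X D {u} \<noteq> {})"

definition circuit_edges :: "'a \<Rightarrow> nat \<Rightarrow> (nat \<Rightarrow> 'a) \<Rightarrow> ('a \<times> 'a) set" where
  "circuit_edges rt l w =
     (if l = 0 then {(rt, rt)}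
      else {(rt, w 1)} \<union> {(w i, w (i + 1)) | i. 1 \<le> i \<and> i < l} \<union> {(w l, rt)})"

text \<open>\<open>(W, F)\<close> is the one-circuit directed graph obtained from the tree \<open>(V, E)\<close> by adjoining
  the new vertices \<open>w 1, \<dots>, w l\<close>. Only the values \<open>w 1, \<dots>, w (l + 1)\<close> are relevant; the
  last of them is the root, by convention.\<close>

definition one_circuit_digraph ::
  "'a set \<Rightarrow> ('a \<times> 'a) set \<Rightarrow> 'a set \<Rightarrow> ('a \<times> 'a) set \<Rightarrow> 'a \<Rightarrow> nat \<Rightarrow> (nat \<Rightarrow> 'a) \<Rightarrow> bool" where
  "one_circuit_digraph W F V E rt l w \<longleftrightarrow>
     rooted_directed_tree V E rt \<and>
     inj_on w {1..l} \<and> w ` {1..l} \<inter> V = {} \<and> w (l + 1) = rt \<and>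
     W = V \<union> w ` {1..l} \<and>
     F = E \<union> circuit_edges rt l w"

definition par :: "'a set \<Rightarrow> ('a \<times> 'a) set \<Rightarrow> 'a \<Rightarrow> 'a" where
  "par W F v = (THE u. u \<in> W \<and> (u, v) \<in> F)"

definition weight_pow :: "'a set \<Rightarrow> ('a \<times> 'a) set \<Rightarrow> ('a \<Rightarrow> real) \<Rightarrow> nat \<Rightarrow> 'a \<Rightarrow> real" where
  "weight_pow W F lam k v = (\<Prod>i<k. lam ((par W F ^^ i) v))"

text \<open>The complex Hilbert space \<open>\<ell>\<^sup>2(W)\<close>. So that equality in \<open>\<ell>\<^sup>2(W)\<close> is equality of HOL
  functions, its elements are represented by functions vanishing off \<open>W\<close>.\<close>

definition ell2 :: "'a set \<Rightarrow> ('a \<Rightarrow> complex) set" where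
  "ell2 W = {f. (\<forall>v. v \<notin> W \<longrightarrow> f v = 0) \<and> (\<lambda>v. (cmod (f v))\<^sup>2) summable_on W}"

definition ell2_norm :: "'a set \<Rightarrow> ('a \<Rightarrow> complex) \<Rightarrow> real" where
  "ell2_norm W f = sqrt (\<Sum>\<^sub>\<infinity>v\<in>W. (cmod (f v))\<^sup>2)"

definition bounded_operator_ell2 ::
  "'a set \<Rightarrow> (('a \<Rightarrow> complex) \<Rightarrow> ('a \<Rightarrow> complex)) \<Rightarrow> bool" where
  "bounded_operator_ell2 W T \<longleftrightarrow>
     (\<forall>f\<in>ell2 W. T f \<in> ell2 W) \<and>
     (\<forall>f\<in>ell2 W. \<forall>g\<in>ell2 W. T (\<lambda>v. f v + g v) = (\<lambda>v. T f v + T g v)) \<and>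
     (\<forall>c. \<forall>f\<in>ell2 W. T (\<lambda>v. c * f v) = (\<lambda>v. c * T f v)) \<and>
     (\<exists>C. \<forall>f\<in>ell2 W. ell2_norm W (T f) \<le> C * ell2_norm W f)"

definition analytic_ell2 ::
  "'a set \<Rightarrow> (('a \<Rightarrow> complex) \<Rightarrow> ('a \<Rightarrow> complex)) \<Rightarrow> bool" where
  "analytic_ell2 W T \<longleftrightarrow> (\<Inter>n. (T ^^ n) ` ell2 W) = {\<lambda>v. 0}"

definition weighted_shift ::
  "'a set \<Rightarrow> ('a \<times> 'a) set \<Rightarrow> ('a \<Rightarrow> real) \<Rightarrow> ('a \<Rightarrow> complex) \<Rightarrow> ('a \<Rightarrow> complex)" where
  "weighted_shift W F lam f =
     (\<lambda>v. if v \<in> W then complex_of_real (lam v) * f (par W F v) else 0)"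

end

theory Submission
  imports Defs
begin

text \<open>Call \<open>u\<close> and \<open>v\<close> equivalent if \<open>par\<^sup>n u = par\<^sup>n v\<close> for some \<open>n\<close>. Since
  \<open>(S\<^sup>n f) v = \<lambda>\<^sup>(\<^sup>n\<^sup>)(v) f (par\<^sup>n v)\<close>, a function \<open>g\<close> in all the ranges of \<open>S\<^sup>n\<close> satisfies
  \<open>g v / \<lambda>\<^sup>(\<^sup>n\<^sup>)(v) = g u / \<lambda>\<^sup>(\<^sup>n\<^sup>)(u)\<close> for equivalent \<open>u\<close>, \<open>v\<close>. The equivalence classes are
  represented by the \<open>l + 1\<close> vertices of the circuit, so such a \<open>g\<close> is determined by its values
  there, and the \<open>k\<close>-th series is the squared norm of the function that is \<open>1\<close> at \<open>w k\<close> and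
  extends to the class of \<open>w k\<close> by this rule. Conversely this function, when square summable, is
  an eigenvector of \<open>S\<^bsup>l+1\<^esup>\<close> with a nonzero eigenvalue and hence lies in all the ranges.\<close>

section \<open>Nonnegative sums over countable disjoint unions of finite sets\<close>

lemma summable_on_UNION_nat_iff:
  fixes f :: "'a \<Rightarrow> real" and B :: "nat \<Rightarrow> 'a set"
  assumes fin: "\<And>m. finite (B m)" and disj: "disjoint_family B"
    and nonneg: "\<And>x. f x \<ge> 0"
  shows "f summable_on (\<Union>m. B m) \<longleftrightarrow> summable (\<lambda>m. \<Sum>x\<in>B m. f x)"
proof
  have part: "(\<Sum>m<N. \<Sum>x\<in>B m. f x) = sum f (\<Union>m<N. B m)" for N
    using disj by (subst sum.UNION_disjoint) (auto simp: fin disjoint_family_on_def)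
  show "summable (\<lambda>m. \<Sum>x\<in>B m. f x)" if "f summable_on (\<Union>m. B m)"
  proof (rule summableI_nonneg_bounded)
    show "(\<Sum>m<N. \<Sum>x\<in>B m. f x) \<le> infsum f (\<Union>m. B m)" for N
      unfolding part by (rule finite_sum_le_infsum[OF that]) (auto simp: fin nonneg)
  qed (simp add: nonneg sum_nonneg)
  show "f summable_on (\<Union>m. B m)" if S: "summable (\<lambda>m. \<Sum>x\<in>B m. f x)"
  proof (rule nonneg_bounded_partial_sums_imp_summable_on)
    show "\<forall>\<^sub>F X in finite_subsets_at_top (\<Union>m. B m). sum f X \<le> (\<Sum>m. \<Sum>x\<in>B m. f x)"
    proof (rule eventually_finite_subsets_at_top_weakI)
      fix X assume X: "finite X" "X \<subseteq> (\<Union>m. B m)"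
      \<comment> \<open>A finite \<open>X\<close> meets only finitely many blocks: \<open>h\<close>
        selects a block for each point, and the largest index selected gives a partial sum
        dominating the sum over \<open>X\<close>.\<close>
      obtain h where h: "\<And>x. x \<in> X \<Longrightarrow> x \<in> B (h x)"
        using X(2) by (metis UN_E subsetD)
      have "X \<subseteq> (\<Union>m<Suc (Max (h ` X)). B m)"
        using h X(1) by (fastforce simp: less_Suc_eq_le)
      then have "sum f X \<le> sum f (\<Union>m<Suc (Max (h ` X)). B m)"
        by (intro sum_mono2) (auto simp: fin nonneg)
      also have "\<dots> = (\<Sum>m<Suc (Max (h ` X)). \<Sum>x\<in>B m. f x)"
        by (simp only: part)
      also have "\<dots> \<le> (\<Sum>m. \<Sum>x\<in>B m. f x)"
        by (rule sum_le_suminf[OF S]) (auto simp: nonneg sum_nonneg)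
      finally show "sum f X \<le> (\<Sum>m. \<Sum>x\<in>B m. f x)" .
    qed
  qed (rule nonneg)
qed

lemma funpow_mult_fixpoint: "(f ^^ c) x = x \<Longrightarrow> (f ^^ (c * n)) x = x"
  by (induction n) (simp_all add: funpow_add)

section \<open>Levels of a rooted directed tree\<close>

lemma Chi_iter_0 [simp]: "Chi_iter X D 0 u = {u}"
  by (simp add: Chi_iter_def)

lemma Chi_iter_Suc: "Chi_iter X D (Suc n) u = Chi X D (Chi_iter X D n u)"
  by (simp add: Chi_iter_def)

lemma mem_Chi_iter_Suc:
  "v \<in> Chi_iter X D (Suc n) u \<longleftrightarrow> v \<in> X \<and> (\<exists>x\<in>Chi_iter X D n u. (x, v) \<in> D)"
  by (auto simp: Chi_iter_Suc Chi_def)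

lemma Chi_iter_subset: "u \<in> X \<Longrightarrow> Chi_iter X D n u \<subseteq> X"
  by (cases n) (auto simp: mem_Chi_iter_Suc)

lemma finite_Chi_iter:
  assumes "locally_finite X D" and "u \<in> X"
  shows "finite (Chi_iter X D n u)"
proof (induction n)
  case (Suc n)
  have "Chi_iter X D (Suc n) u = (\<Union>x\<in>Chi_iter X D n u. Chi X D {x})"
    by (auto simp: Chi_iter_Suc Chi_def)
  then show ?case
    using Suc assms Chi_iter_subset[OF assms(2), of D n] by (auto simp: locally_finite_def)
qed simp

text \<open>No edge enters the root and parents are unique elsewhere, so two descents from the root
  to \<open>v\<close> can be stripped of their last edges in parallel until one of them is
  empty.\<close>

lemma disjoint_Chi_iter_root:
  assumes T: "rooted_directed_tree V E rt"
    and "v \<in> Chi_iter V E m rt" and "v \<in> Chi_iter V E n rt"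
  shows "m = n"
  using assms(2,3)
proof (induction m arbitrary: n v)
  case 0
  then show ?case
    using T by (cases n) (auto simp: mem_Chi_iter_Suc rooted_directed_tree_def)
next
  case (Suc m)
  then obtain x where x: "x \<in> Chi_iter V E m rt" "(x, v) \<in> E" "v \<in> V"
    by (auto simp: mem_Chi_iter_Suc)
  with T have "v \<noteq> rt" by (auto simp: rooted_directed_tree_def)
  with Suc.prems obtain n' y where y: "n = Suc n'" "y \<in> Chi_iter V E n' rt" "(y, v) \<in> E"
    by (cases n) (auto simp: mem_Chi_iter_Suc)
  have "x = y"
    using T x y \<open>v \<noteq> rt\<close> unfolding rooted_directed_tree_def by blast
  with Suc.IH x y show ?case by auto
qed

text \<open>Follow an undirected path from the root: an edge traversed forwards raises the level by
  one, and one traversed backwards lowers it by one because the parent is unique.\<close>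

lemma rooted_directed_tree_levels:
  assumes T: "rooted_directed_tree V E rt" and "v \<in> V"
  shows "\<exists>n. v \<in> Chi_iter V E n rt"
proof -
  have "(rt, v) \<in> (E \<union> E\<inverse>)\<^sup>*"
    using assms unfolding rooted_directed_tree_def by blast
  then show ?thesis
  proof induction
    case base
    have "rt \<in> Chi_iter V E 0 rt" by simp
    then show ?case ..
  next
    case (step y z)
    then obtain n where n: "y \<in> Chi_iter V E n rt" by blast
    from step.hyps consider "(y, z) \<in> E" | "(z, y) \<in> E" by blast
    then show ?case
    proof cases
      case 1
      with n T have "z \<in> Chi_iter V E (Suc n) rt"
        by (auto simp: mem_Chi_iter_Suc rooted_directed_tree_def)
      then show ?thesis ..
    next
      case 2
      with T have "y \<noteq> rt" by (auto simp: rooted_directed_tree_def)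
      with n obtain n' x where x: "x \<in> Chi_iter V E n' rt" "(x, y) \<in> E"
        by (cases n) (auto simp: mem_Chi_iter_Suc)
      with 2 T \<open>y \<noteq> rt\<close> have "x = z"
        unfolding rooted_directed_tree_def by blast
      with x show ?thesis by blast
    qed
  qed
qed

text \<open>Puts the loop \<open>l = 0\<close> and the longer circuits into one indexed family, one
  edge into each \<open>w k\<close>, so that \<open>l = 0\<close> needs no separate treatment
  later.\<close>

lemma circuit_edges_eq:
  assumes "w (l + 1) = rt"
  shows "circuit_edges rt l w = (\<lambda>k. (if k = 1 then rt else w (k - 1), w k)) ` {1..l + 1}"
proof (cases "l = 0")
  case True
  with assms show ?thesis by (simp add: circuit_edges_def)
next
  case False
  have "{1..l + 1} = insert 1 (insert (l + 1) ((\<lambda>i. i + 1) ` {i. 1 \<le> i \<and> i < l}))"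
  proof (intro set_eqI iffI)
    fix k assume k: "k \<in> {1..l + 1}"
    then consider "k = 1" | "k = l + 1" | "k - 1 \<in> {i. 1 \<le> i \<and> i < l}" "k = k - 1 + 1"
      by fastforce
    then show "k \<in> insert 1 (insert (l + 1) ((\<lambda>i. i + 1) ` {i. 1 \<le> i \<and> i < l}))"
      by cases blast+
  qed (use False in auto)
  moreover have "{(w i, w (i + 1)) | i. 1 \<le> i \<and> i < l}
      = (\<lambda>k. (if k = 1 then rt else w (k - 1), w k)) ` (\<lambda>i. i + 1) ` {i. 1 \<le> i \<and> i < l}"
    by (auto simp: image_image)
  ultimately show ?thesis
    using False assms by (auto simp: circuit_edges_def)
qed

section \<open>The one-circuit graph and its parent map\<close>

locale one_circuit =
  fixes W V :: "'a set" and F E :: "('a \<times> 'a) set" and rt :: 'a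
    and l :: nat and w :: "nat \<Rightarrow> 'a" and lam :: "'a \<Rightarrow> real"
  assumes graph: "one_circuit_digraph W F V E rt l w"
    and pos: "\<And>v. v \<in> W \<Longrightarrow> lam v > 0"
begin

abbreviation p :: "'a \<Rightarrow> 'a" where "p \<equiv> par W F"
abbreviation wp :: "nat \<Rightarrow> 'a \<Rightarrow> real" where "wp \<equiv> weight_pow W F lam"

lemma tree: "rooted_directed_tree V E rt"
  using graph by (simp add: one_circuit_digraph_def)

lemma
  shows root_in_V: "rt \<in> V" and no_edge_to_root: "(u, rt) \<notin> E" and edges_in_V: "E \<subseteq> V \<times> V"
  using tree by (auto simp: rooted_directed_tree_def)

lemma w_last: "w (l + 1) = rt"
  using graph by (simp add: one_circuit_digraph_def)

lemma W_eq: "W = V \<union> w ` {1..l}"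
  using graph by (simp add: one_circuit_digraph_def)

lemma V_subset_W: "V \<subseteq> W"
  by (simp add: W_eq)

lemma root_in_W: "rt \<in> W"
  using root_in_V V_subset_W by blast

lemma w_in_V_iff: "k \<in> {1..l + 1} \<Longrightarrow> w k \<in> V \<longleftrightarrow> k = l + 1"
proof (cases "k = l + 1")
  case True
  then show ?thesis using root_in_V w_last by simp
next
  case False
  assume "k \<in> {1..l + 1}"
  with False have "w k \<in> w ` {1..l}" by auto
  then have "w k \<notin> V" using graph unfolding one_circuit_digraph_def by blast
  with False show ?thesis by simp
qed

lemma w_in_W: "k \<in> {1..l + 1} \<Longrightarrow> w k \<in> W"
  using root_in_V w_last by (cases "k = l + 1") (auto simp: W_eq)

lemma inj_w: "inj_on w {1..l + 1}"
proof -
  have "{1..l + 1} = insert (l + 1) {1..l}" by auto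
  moreover have "inj_on w (insert (l + 1) {1..l})"
    using graph root_in_V by (auto simp: one_circuit_digraph_def)
  ultimately show ?thesis by simp
qed

lemma edge_iff:
  "(u, v) \<in> F \<longleftrightarrow> (u, v) \<in> E \<or> (\<exists>k\<in>{1..l + 1}. v = w k \<and> u = (if k = 1 then rt else w (k - 1)))"
proof -
  have "F = E \<union> circuit_edges rt l w"
    using graph by (simp add: one_circuit_digraph_def)
  then show ?thesis by (auto simp only: circuit_edges_eq[of w l rt, OF w_last])
qed

text \<open>No tree edge ends on the circuit, since \<open>w 1\<close>, ..., \<open>w l\<close> lie
  outside \<open>V\<close> and \<open>w (l + 1)\<close> is the root.\<close>

lemma edge_to_w_iff:
  assumes "k \<in> {1..l + 1}"
  shows "(u, w k) \<in> F \<longleftrightarrow> u = (if k = 1 then rt else w (k - 1))"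
proof -
  have "(u, w k) \<notin> E"
    using assms w_in_V_iff[OF assms] edges_in_V no_edge_to_root w_last by (cases "k = l + 1") auto
  with assms show ?thesis
    unfolding edge_iff using inj_on_eq_iff[OF inj_w] by auto
qed

lemma circuit_pred_in_W: "k \<in> {1..l + 1} \<Longrightarrow> (if k = 1 then rt else w (k - 1)) \<in> W"
proof (cases "k = 1")
  case False
  assume "k \<in> {1..l + 1}"
  with False have "k - 1 \<in> {1..l + 1}" by auto
  with False show ?thesis by (simp only: w_in_W if_False)
qed (simp add: root_in_W)

lemma circuit_pred_notin_V:
  assumes "k \<in> {1..l + 1}" and "k \<noteq> 1"
  shows "w (k - 1) \<notin> V"
proof -
  from assms have "k - 1 \<in> {1..l + 1}" "k - 1 \<noteq> l + 1" by auto
  with w_in_V_iff show ?thesis by metis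
qed

text \<open>Each circuit vertex has just one circuit edge leaving it. The root is recognised among
  the sources as the only one in \<open>V\<close>.\<close>

lemma circuit_pred_inj:
  assumes jk: "j \<in> {1..l + 1}" "k \<in> {1..l + 1}"
    and eq: "(if j = 1 then rt else w (j - 1)) = (if k = 1 then rt else w (k - 1))"
  shows "j = k"
proof -
  have "j - 1 = k - 1" if "j \<noteq> 1" "k \<noteq> 1"
  proof (rule inj_onD[OF inj_w])
    show "j - 1 \<in> {1..l + 1}" "k - 1 \<in> {1..l + 1}"
      using that jk by auto
  qed (use eq that in simp)
  moreover have "j = 1 \<longleftrightarrow> k = 1"
    using eq circuit_pred_notin_V root_in_V jk by metis
  ultimately show ?thesis using jk by (cases "j = 1") auto
qed

lemma par_w:
  assumes "k \<in> {1..l + 1}"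
  shows "p (w k) = (if k = 1 then rt else w (k - 1))"
  unfolding par_def edge_to_w_iff[OF assms]
  using circuit_pred_in_W[OF assms] by (intro the_equality) auto

lemma par_edge:
  assumes "(u, v) \<in> E"
  shows "p v = u"
proof -
  have uv: "u \<in> V" "v \<in> V" "v \<noteq> rt"
    using assms edges_in_V no_edge_to_root by auto
  then have "v \<noteq> w k" if "k \<in> {1..l + 1}" for k
    using w_in_V_iff[OF that] w_last by auto
  then have iff: "(x, v) \<in> F \<longleftrightarrow> (x, v) \<in> E" for x
    by (auto simp: edge_iff)
  have "x = u" if "(x, v) \<in> E" for x
    using that assms uv tree edges_in_V unfolding rooted_directed_tree_def by blast
  moreover have "u \<in> W" using uv(1) W_eq by blast
  ultimately show ?thesis
    unfolding par_def iff using assms by (intro the_equality) blast+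
qed

lemma par_in_W:
  assumes "v \<in> W"
  shows "p v \<in> W"
proof (cases "v \<in> V - {rt}")
  case True
  then obtain u where "(u, v) \<in> E" "u \<in> V"
    using tree unfolding rooted_directed_tree_def by blast
  then show ?thesis using par_edge W_eq by blast
next
  case False
  with assms have "v = w (l + 1) \<or> v \<in> w ` {1..l}"
    unfolding w_last by (auto simp: W_eq)
  then obtain k where "k \<in> {1..l + 1}" "v = w k"
    by fastforce
  then show ?thesis
    using circuit_pred_in_W par_w by metis
qed

lemma par_funpow_in_W: "v \<in> W \<Longrightarrow> (p ^^ n) v \<in> W"
  by (induction n) (auto simp: par_in_W)

lemma par_funpow_level: "v \<in> Chi_iter V E n rt \<Longrightarrow> (p ^^ n) v = rt"
proof (induction n arbitrary: v)
  case (Suc n)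
  then obtain x where "x \<in> Chi_iter V E n rt" "(x, v) \<in> E"
    by (auto simp: mem_Chi_iter_Suc)
  with Suc.IH show ?case
    unfolding funpow_Suc_right by (simp add: par_edge)
qed simp

lemma par_funpow_w: "k \<in> {1..l + 1} \<Longrightarrow> (p ^^ k) (w k) = rt"
proof (induction k)
  case (Suc k)
  show ?case
  proof (cases "k = 0")
    case True
    with par_w[OF Suc.prems] show ?thesis by simp
  next
    case False
    with Suc have "(p ^^ k) (w k) = rt" by auto
    then show ?thesis
      using False par_w[OF Suc.prems] unfolding funpow_Suc_right by simp
  qed
qed simp

lemma par_funpow_circuit_root: "(p ^^ ((l + 1) * m)) rt = rt"
  by (rule funpow_mult_fixpoint) (use par_funpow_w[of "l + 1"] w_last in simp)

text \<open>The vertices of tree level \<open>(l + 1) * m + k\<close> reach the root after the same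
  number of steps, which makes them equivalent to \<open>w k\<close>.\<close>

lemma par_funpow_w': "k \<in> {1..l + 1} \<Longrightarrow> (p ^^ ((l + 1) * m + k)) (w k) = rt"
  using par_funpow_circuit_root par_funpow_w by (simp add: funpow_add del: mult_Suc)

lemma par_funpow_w_less:
  assumes "k \<in> {1..l + 1}"
  shows "j < k \<Longrightarrow> (p ^^ j) (w k) = w (k - j)"
proof (induction j)
  case (Suc j)
  then have "k - j \<in> {1..l + 1}" "k - j \<noteq> 1" "k - j - 1 = k - Suc j"
    using assms by auto
  then have "p (w (k - j)) = w (k - Suc j)"
    using par_w by metis
  with Suc show ?case by simp
qed simp

lemma par_funpow_w_circuit:
  assumes k: "k \<in> {1..l + 1}"
  shows "(p ^^ (l + 1)) (w k) = w k"
proof -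
  have "(p ^^ (l + 1)) (w k) = (p ^^ (l + 1 - k)) ((p ^^ k) (w k))"
    using k funpow_add[of "l + 1 - k" k p] by simp
  also have "\<dots> = (p ^^ (l + 1 - k)) (w (l + 1))"
    unfolding w_last using k by (simp add: par_funpow_w)
  also have "\<dots> = w k"
    using k by (subst par_funpow_w_less) auto
  finally show ?thesis .
qed

lemma par_funpow_w_circuit': "k \<in> {1..l + 1} \<Longrightarrow> (p ^^ ((l + 1) * n)) (w k) = w k"
  by (rule funpow_mult_fixpoint) (rule par_funpow_w_circuit)

text \<open>Up to step \<open>l + 1\<close> the descent in the graph runs through the tree levels
  and, in parallel, once along the circuit; the root is re-entered only at the last step, so no
  second copy of the tree is started.\<close>

lemma Chi_iter_circuit:
  assumes "k \<in> {1..l + 1}"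
  shows "Chi_iter W F k rt = insert (w k) (Chi_iter V E k rt)"
  using assms
proof (induction k)
  case (Suc k)
  \<comment> \<open>\<open>?c\<close> is the circuit vertex reached after \<open>k\<close> steps;
    the root takes the place of \<open>w 0\<close>.\<close>
  let ?c = "if k = 0 then rt else w k"
  have edge: "(u, v) \<in> F \<longleftrightarrow> (u, v) \<in> E \<or> v = w (Suc k) \<and> u = ?c"
    if u: "u = ?c \<or> u \<in> Chi_iter V E k rt" for u v
  proof -
    have "j = Suc k \<and> u = ?c"
      if j: "j \<in> {1..l + 1}" and uj: "u = (if j = 1 then rt else w (j - 1))" for j
    proof (cases "u = ?c")
      case True
      then have "(if j = 1 then rt else w (j - 1)) = (if Suc k = 1 then rt else w (Suc k - 1))"
        using uj by simp
      from circuit_pred_inj[OF j Suc.prems this] True show ?thesis by simp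
    next
      case False
      with u have uk: "u \<in> Chi_iter V E k rt" and "u \<in> V"
        using Chi_iter_subset[OF root_in_V] by auto
      \<comment> \<open>The only source of a circuit edge inside \<open>V\<close> is the root, whose
        level is 0; this forces \<open>k = 0\<close> and hence \<open>u = ?c\<close>.\<close>
      have "u = rt"
        using uj \<open>u \<in> V\<close> circuit_pred_notin_V[OF j] by metis
      then have "rt \<in> Chi_iter V E k rt" "rt \<in> Chi_iter V E 0 rt"
        using uk by auto
      then have "k = 0" by (rule disjoint_Chi_iter_root[OF tree])
      with False \<open>u = rt\<close> show ?thesis by simp
    qed
    moreover have "u = ?c \<longleftrightarrow> u = (if Suc k = 1 then rt else w (Suc k - 1))"
      by simp
    ultimately show ?thesis
      using Suc.prems unfolding edge_iff by metis
  qed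
  have prev: "Chi_iter W F k rt = insert ?c (Chi_iter V E k rt)"
    using Suc by (cases "k = 0") auto
  \<comment> \<open>\<open>?c\<close> contributes no tree edge of its own: for \<open>k > 0\<close>
    it lies outside \<open>V\<close>, and for \<open>k = 0\<close> it is the root, which already
    forms the level.\<close>
  have "w k \<notin> V" if "k \<noteq> 0"
    using that Suc.prems w_in_V_iff[of k] by auto
  then have tree_edge: "\<exists>x\<in>Chi_iter V E k rt. (x, v) \<in> E" if "(?c, v) \<in> E" for v
    using that edges_in_V by (cases "k = 0") auto
  show ?case
  proof (rule set_eqI)
    fix v
    have "v \<in> Chi_iter W F (Suc k) rt
        \<longleftrightarrow> v \<in> W \<and> ((?c, v) \<in> F \<or> (\<exists>x\<in>Chi_iter V E k rt. (x, v) \<in> F))"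
      unfolding mem_Chi_iter_Suc prev by blast
    also have "\<dots> \<longleftrightarrow> v \<in> W \<and> (v = w (Suc k) \<or> (\<exists>x\<in>Chi_iter V E k rt. (x, v) \<in> E))"
      using edge tree_edge by blast
    also have "\<dots> \<longleftrightarrow> v \<in> insert (w (Suc k)) (Chi_iter V E (Suc k) rt)"
      unfolding mem_Chi_iter_Suc insert_iff
      using w_in_W[OF Suc.prems] edges_in_V V_subset_W by blast
    finally show "v \<in> Chi_iter W F (Suc k) rt \<longleftrightarrow> v \<in> insert (w (Suc k)) (Chi_iter V E (Suc k) rt)" .
  qed
qed simp

section \<open>The index sets of the series as equivalence classes of vertices\<close>

definition block :: "nat \<Rightarrow> nat \<Rightarrow> 'a set" where
  "block k m = (if m = 0 then Chi_iter W F k rt else Chi_iter V E ((l + 1) * m + k) rt)"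

text \<open>Taking children in the graph for \<open>m = 0\<close> adds exactly the representative
  \<open>w k\<close> to the tree levels \<open>(l + 1) * m + k\<close>.\<close>

lemma block_eq:
  assumes "k \<in> {1..l + 1}"
  shows "block k m = (if m = 0 then {w k} else {}) \<union> Chi_iter V E ((l + 1) * m + k) rt"
  using Chi_iter_circuit[OF assms] by (simp add: block_def)

lemma par_funpow_block:
  assumes k: "k \<in> {1..l + 1}" and "v \<in> block k m"
  shows "(p ^^ ((l + 1) * m + k)) v = (p ^^ ((l + 1) * m + k)) (w k)"
  using assms par_funpow_level[of v "(l + 1) * m + k"]
  by (auto simp only: block_eq[OF k] par_funpow_w'[OF k] split: if_splits)

lemma finite_block: "locally_finite V E \<Longrightarrow> k \<in> {1..l + 1} \<Longrightarrow> finite (block k m)"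
  using finite_Chi_iter[OF _ root_in_V] by (auto simp: block_eq)

lemma block_subset: "k \<in> {1..l + 1} \<Longrightarrow> block k m \<subseteq> W"
  using Chi_iter_subset[OF root_in_V, of E "(l + 1) * m + k"] w_in_W[of k] V_subset_W
  by (auto simp: block_eq split: if_splits)

text \<open>The case with content is \<open>k = l + 1\<close>: there \<open>w k\<close> is the root
  and belongs to the tree, but only to level 0.\<close>

lemma w_notin_level: "k \<in> {1..l + 1} \<Longrightarrow> n > 0 \<Longrightarrow> w k \<notin> Chi_iter V E n rt"
proof
  assume k: "k \<in> {1..l + 1}" and n: "n > 0" and wk: "w k \<in> Chi_iter V E n rt"
  then have "w k \<in> V" using Chi_iter_subset[OF root_in_V] by blast
  with w_in_V_iff[OF k] w_last have "w k = rt" by simp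
  then have "w k \<in> Chi_iter V E 0 rt" by simp
  from disjoint_Chi_iter_root[OF tree wk this] n show False by simp
qed

lemma disjoint_block:
  assumes k: "k \<in> {1..l + 1}"
  shows "disjoint_family (block k)"
proof -
  have "m = n" if mn: "v \<in> block k m" "v \<in> block k n" for v m n
  proof (cases "v = w k")
    case True
    with mn w_notin_level[OF k] k show ?thesis
      by (auto simp: block_eq split: if_splits)
  next
    case False
    with mn k have "(l + 1) * m + k = (l + 1) * n + k"
      by (intro disjoint_Chi_iter_root[OF tree]) (auto simp: block_eq split: if_splits)
    then show ?thesis by (simp del: mult_Suc)
  qed
  then show ?thesis by (auto simp: disjoint_family_on_def)
qed

lemma in_some_block:
  assumes "v \<in> W"
  shows "\<exists>k\<in>{1..l + 1}. \<exists>m. v \<in> block k m"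
proof (cases "v \<in> V - {rt}")
  case True
  then obtain n where n: "v \<in> Chi_iter V E n rt"
    using rooted_directed_tree_levels[OF tree] by blast
  with True have "n \<noteq> 0" by (cases n) auto
  \<comment> \<open>Dividing \<open>n - 1\<close> instead of \<open>n\<close> makes the residue
    \<open>k\<close> run through \<open>1\<close>, ..., \<open>l + 1\<close>.\<close>
  define k m where "k = (n - 1) mod (l + 1) + 1" and "m = (n - 1) div (l + 1)"
  have k: "k \<in> {1..l + 1}"
    by (simp add: k_def Suc_le_eq)
  have "(l + 1) * m + k = n"
    using \<open>n \<noteq> 0\<close> mult_div_mod_eq[of "l + 1" "n - 1"] unfolding k_def m_def by linarith
  then have "v \<in> block k m"
    using n unfolding block_eq[OF k] by simp
  with k show ?thesis by blast
next
  case False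
  with assms have "v = w (l + 1) \<or> v \<in> w ` {1..l}"
    unfolding w_last by (auto simp: W_eq)
  then obtain k where k: "k \<in> {1..l + 1}" "v = w k"
    by fastforce
  then have "v \<in> block k 0" by (simp add: block_eq)
  with k show ?thesis by blast
qed

lemma funpow_par_eq_mono:
  assumes "(p ^^ n) u = (p ^^ n) v" and "n \<le> n'"
  shows "(p ^^ n') u = (p ^^ n') v"
proof -
  have "p ^^ n' = p ^^ (n' - n) \<circ> p ^^ n"
    using assms(2) by (simp flip: funpow_add)
  with assms(1) show ?thesis by simp
qed

text \<open>The blocks cover \<open>W\<close> and each consists of vertices equivalent to its
  circuit vertex; distinct circuit vertices are inequivalent because full rounds fix all of
  them.\<close>

lemma UN_block:
  assumes k: "k \<in> {1..l + 1}"
  shows "(\<Union>m. block k m) = {v \<in> W. \<exists>n. (p ^^ n) v = (p ^^ n) (w k)}"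
proof (intro equalityI subsetI)
  fix v assume "v \<in> {v \<in> W. \<exists>n. (p ^^ n) v = (p ^^ n) (w k)}"
  then obtain n where v: "v \<in> W" and n: "(p ^^ n) v = (p ^^ n) (w k)" by blast
  from in_some_block[OF v] obtain j m where j: "j \<in> {1..l + 1}" and m: "v \<in> block j m" by blast
  \<comment> \<open>\<open>N\<close> is at least both exponents, so the two coincidences persist,
    and it is a multiple of \<open>l + 1\<close>, so that \<open>p ^^ N\<close> fixes
    \<open>w k\<close> and \<open>w j\<close>.\<close>
  define N where "N = (l + 1) * (n + (l + 1) * m + j)"
  have "n \<le> N" "(l + 1) * m + j \<le> N" unfolding N_def by auto
  then have "(p ^^ N) (w k) = (p ^^ N) (w j)"
    using funpow_par_eq_mono[OF n] funpow_par_eq_mono[OF par_funpow_block[OF j m]] by metis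
  then have "w k = w j"
    using par_funpow_w_circuit'[OF k] par_funpow_w_circuit'[OF j] by (simp only: N_def)
  with inj_w j k have "j = k" by (metis inj_on_eq_iff)
  with m show "v \<in> (\<Union>m. block k m)" by blast
next
  fix v assume "v \<in> (\<Union>m. block k m)"
  then show "v \<in> {v \<in> W. \<exists>n. (p ^^ n) v = (p ^^ n) (w k)}"
    using par_funpow_block[OF k] block_subset[OF k] by blast
qed

section \<open>Weights along ancestors and the extension of a value to its class\<close>

lemma wp_pos: "v \<in> W \<Longrightarrow> wp n v > 0"
  unfolding weight_pow_def by (intro prod_pos) (auto intro: pos par_funpow_in_W)

lemma wp_add: "wp (m + n) v = wp m v * wp n ((p ^^ m) v)"
proof -
  have "(p ^^ (i + m)) v = (p ^^ i) ((p ^^ m) v)" for i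
    by (simp add: funpow_add)
  then show ?thesis
    unfolding weight_pow_def lessThan_atLeast0
    using prod.atLeastLessThan_concat[of 0 m "m + n" "\<lambda>i. lam ((p ^^ i) v)"]
      prod.shift_bounds_nat_ivl[of "\<lambda>i. lam ((p ^^ i) v)" 0 m n]
    by (simp add: add.commute)
qed

text \<open>Once the two ancestor paths have merged, further steps multiply numerator and
  denominator by the same positive factor.\<close>

lemma wp_ratio_mono:
  assumes "u \<in> W" and "(p ^^ n) v = (p ^^ n) u" and "n \<le> n'"
  shows "wp n' v / wp n' u = wp n v / wp n u"
proof -
  obtain d where "n' = n + d" using assms(3) le_Suc_ex by blast
  moreover have "wp d ((p ^^ n) u) > 0"
    using assms(1) by (intro wp_pos par_funpow_in_W)
  ultimately show ?thesis by (simp add: wp_add assms(2))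
qed

text \<open>The candidate eigenvector supported on the class of \<open>u\<close>.
  \<open>LEAST\<close> merely fixes a merging time; by \<open>ratio_eq\<close> every other one gives
  the same value.\<close>

definition ratio :: "'a \<Rightarrow> 'a \<Rightarrow> real" where
  "ratio u v = (if v \<in> W \<and> (\<exists>n. (p ^^ n) v = (p ^^ n) u)
     then let n = (LEAST n. (p ^^ n) v = (p ^^ n) u) in wp n v / wp n u else 0)"

lemma ratio_eq:
  assumes "u \<in> W" "v \<in> W" "(p ^^ n) v = (p ^^ n) u"
  shows "ratio u v = wp n v / wp n u"
proof -
  let ?n = "LEAST n. (p ^^ n) v = (p ^^ n) u"
  have "(p ^^ ?n) v = (p ^^ ?n) u" "?n \<le> n"
    using assms(3) by (rule LeastI, rule Least_le)
  then have "wp n v / wp n u = wp ?n v / wp ?n u"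
    by (intro wp_ratio_mono assms(1))
  then show ?thesis
    using assms by (auto simp: ratio_def Let_def)
qed

lemma ratio_self: "u \<in> W \<Longrightarrow> ratio u u = 1"
  using ratio_eq[of u u 0] by (simp add: weight_pow_def)

text \<open>The eigenvector equation: the left side is the \<open>c\<close>-th power of the shift
  applied to \<open>ratio u\<close>, and the eigenvalue is \<open>wp c u\<close>. It follows by
  splitting the weights of length \<open>c + n\<close> after \<open>c\<close> steps, where
  \<open>u\<close> has returned to itself.\<close>

lemma ratio_circuit:
  assumes u: "u \<in> W" "(p ^^ c) u = u" and v: "v \<in> W"
  shows "wp c v * ratio u ((p ^^ c) v) = wp c u * ratio u v"
proof (cases "\<exists>n. (p ^^ n) v = (p ^^ n) u")
  case True
  then obtain n where n: "(p ^^ n) v = (p ^^ n) u" by blast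
  have n': "(p ^^ (c + n)) v = (p ^^ (c + n)) u"
    by (rule funpow_par_eq_mono[OF n]) simp
  then have "(p ^^ n) ((p ^^ c) v) = (p ^^ n) u"
    using u(2) by (simp add: add.commute[of c] funpow_add)
  from ratio_eq[OF u(1) par_funpow_in_W[OF v] this] ratio_eq[OF u(1) v n'] u(2) wp_pos[OF u(1), of c]
  show ?thesis by (simp add: wp_add)
next
  case False
  have "(p ^^ n) ((p ^^ c) v) \<noteq> (p ^^ n) u" for n
  proof
    assume "(p ^^ n) ((p ^^ c) v) = (p ^^ n) u"
    then have "(p ^^ (n + c)) v = (p ^^ (n + c)) u"
      using u(2) by (simp add: funpow_add)
    with False show False by blast
  qed
  with False show ?thesis by (simp add: ratio_def)
qed

section \<open>Powers of the shift, the series and analyticity\<close>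

lemma weighted_shift_funpow:
  assumes "v \<in> W"
  shows "((weighted_shift W F lam ^^ n) f) v = complex_of_real (wp n v) * f ((p ^^ n) v)"
  using assms
proof (induction n arbitrary: v)
  case (Suc n)
  have "wp (Suc n) v = lam v * wp n (p v)"
    using wp_add[of 1 n v] by (simp add: weight_pow_def)
  moreover have "((weighted_shift W F lam ^^ Suc n) f) v
      = complex_of_real (lam v) * ((weighted_shift W F lam ^^ n) f) (p v)"
    using Suc.prems by (simp add: weighted_shift_def)
  ultimately show ?case
    using Suc.IH[OF par_in_W[OF Suc.prems]] by (simp add: funpow_Suc_right del: funpow.simps(2))
qed (simp add: weight_pow_def)

text \<open>The series is the sum of the squares of \<open>ratio (w k)\<close> grouped by blocks,
  which are finite and disjoint; off their union \<open>ratio (w k)\<close> vanishes.\<close>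

lemma summable_series_iff:
  assumes k: "k \<in> {1..l + 1}" and lf: "locally_finite V E"
  shows "summable (\<lambda>m::nat.
       if m = 0 then
         (\<Sum>v\<in>Chi_iter W F k rt. (wp k v / wp k (w k))\<^sup>2)
       else
         (\<Sum>v\<in>Chi_iter V E ((l + 1) * m + k) rt.
            (wp ((l + 1) * m + k) v / wp ((l + 1) * m + k) (w k))\<^sup>2))
    \<longleftrightarrow> (\<lambda>v. (ratio (w k) v)\<^sup>2) summable_on W" (is "summable ?s \<longleftrightarrow> _")
proof -
  have "?s m = (\<Sum>v\<in>block k m. (wp ((l + 1) * m + k) v / wp ((l + 1) * m + k) (w k))\<^sup>2)" for m
    by (simp add: block_def)
  also have "\<dots> m = (\<Sum>v\<in>block k m. (ratio (w k) v)\<^sup>2)" for m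
    using block_subset[OF k, of m] par_funpow_block[OF k, of _ m]
    by (intro sum.cong refl) (subst ratio_eq[OF w_in_W[OF k]], auto)
  finally have "summable ?s \<longleftrightarrow> (\<lambda>v. (ratio (w k) v)\<^sup>2) summable_on (\<Union>m. block k m)"
    using summable_on_UNION_nat_iff[OF finite_block[OF lf k] disjoint_block[OF k],
        of "\<lambda>v. (ratio (w k) v)\<^sup>2"] by simp
  also have "\<dots> \<longleftrightarrow> (\<lambda>v. (ratio (w k) v)\<^sup>2) summable_on W"
    unfolding UN_block[OF k] by (intro summable_on_cong_neutral) (auto simp: ratio_def)
  finally show ?thesis .
qed

text \<open>For \<open>n\<close> a merging time of \<open>v\<close> and \<open>w k\<close>, both
  values of \<open>g\<close> are weights times the value of one preimage \<open>f\<close> at the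
  same ancestor.\<close>

lemma range_function_eq_ratio:
  assumes g: "\<And>n. g \<in> (weighted_shift W F lam ^^ n) ` A"
    and k: "k \<in> {1..l + 1}" and v: "v \<in> block k m"
  shows "g v = complex_of_real (ratio (w k) v) * g (w k)"
proof -
  define n where "n = (l + 1) * m + k"
  obtain f where f: "g = (weighted_shift W F lam ^^ n) f"
    using g by blast
  have W: "v \<in> W" "w k \<in> W"
    using block_subset[OF k] v w_in_W[OF k] by auto
  have n: "(p ^^ n) v = (p ^^ n) (w k)"
    unfolding n_def by (rule par_funpow_block[OF k v])
  show ?thesis
    using wp_pos[OF W(2), of n]
    by (simp add: f weighted_shift_funpow W ratio_eq[OF W(2,1) n] n)
qed

lemma analytic_ell2_iff:
  assumes S: "\<And>f. f \<in> ell2 W \<Longrightarrow> weighted_shift W F lam f \<in> ell2 W"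
  shows "analytic_ell2 W (weighted_shift W F lam) \<longleftrightarrow>
    (\<forall>k\<in>{1..l + 1}. \<not> (\<lambda>v. (ratio (w k) v)\<^sup>2) summable_on W)"
proof (intro iffI ballI notI)
  fix k assume an: "analytic_ell2 W (weighted_shift W F lam)" and k: "k \<in> {1..l + 1}"
    and sum: "(\<lambda>v. (ratio (w k) v)\<^sup>2) summable_on W"
  let ?S = "weighted_shift W F lam"
  define g where "g = (\<lambda>v. complex_of_real (ratio (w k) v))"
  note wk = w_in_W[OF k]
  have scale: "(\<lambda>v. a * g v) \<in> ell2 W" for a
    using summable_on_cmult_right[OF sum, of "(cmod a)\<^sup>2"]
    by (auto simp: ell2_def g_def ratio_def norm_mult power_mult_distrib)
  have maps: "(?S ^^ n) f \<in> ell2 W" if "f \<in> ell2 W" for f n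
    using that by (induction n) (auto intro: S)
  have off: "h v = 0" if "h \<in> ell2 W" "v \<notin> W" for h v
    using that by (auto simp: ell2_def)
  have "g \<in> (?S ^^ n) ` ell2 W" for n
  proof -
    \<comment> \<open>A multiple of \<open>l + 1\<close> keeps \<open>w k\<close> fixed, and
      \<open>c\<close> is at least \<open>n\<close>, so the range of the \<open>c\<close>-th power
      lies in that of the \<open>n\<close>-th. The factor \<open>?a\<close> cancels the
      eigenvalue.\<close>
    define c where "c = (l + 1) * n"
    let ?a = "inverse (complex_of_real (wp c (w k)))"
    have "(?S ^^ c) (\<lambda>v. ?a * g v) = g"
    proof
      fix v show "(?S ^^ c) (\<lambda>v. ?a * g v) v = g v"
      proof (cases "v \<in> W")
        case True
        have c: "(p ^^ c) (w k) = w k"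
          unfolding c_def by (rule par_funpow_w_circuit'[OF k])
        have "complex_of_real (wp c v) * g ((p ^^ c) v) = complex_of_real (wp c (w k)) * g v"
          using ratio_circuit[OF wk c True] unfolding g_def by (simp flip: of_real_mult)
        then show ?thesis
          using wp_pos[OF wk, of c] by (simp add: weighted_shift_funpow True field_simps)
      next
        case False
        then show ?thesis
          using off[OF maps[OF scale] False] by (simp add: g_def ratio_def)
      qed
    qed
    moreover have "c = n + (c - n)" unfolding c_def by simp
    then have "?S ^^ c = ?S ^^ n \<circ> ?S ^^ (c - n)"
      by (metis funpow_add)
    ultimately have "(?S ^^ n) ((?S ^^ (c - n)) (\<lambda>v. ?a * g v)) = g"
      by simp
    then show ?thesis
      using maps[OF scale] by (metis image_eqI)
  qed
  then have "g = (\<lambda>v. 0)"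
    using an unfolding analytic_ell2_def by blast
  then show False
    using ratio_self[OF wk] by (auto simp: g_def fun_eq_iff)
next
  let ?S = "weighted_shift W F lam"
  assume diverge: "\<forall>k\<in>{1..l + 1}. \<not> (\<lambda>v. (ratio (w k) v)\<^sup>2) summable_on W"
  have "g = (\<lambda>v. 0)" if "g \<in> (\<Inter>n. (?S ^^ n) ` ell2 W)" for g
  proof
    have range: "g \<in> (?S ^^ n) ` ell2 W" for n
      using that by blast
    have g: "g \<in> ell2 W"
      using range[of 0] by simp
    fix v show "g v = 0"
    proof (cases "v \<in> W")
      case True
      then obtain k m where k: "k \<in> {1..l + 1}" and v: "v \<in> block k m"
        using in_some_block by blast
      have "g (w k) = 0"
      proof (rule ccontr)
        assume nz: "g (w k) \<noteq> 0"
        have "(\<lambda>u. inverse ((cmod (g (w k)))\<^sup>2) * (cmod (g u))\<^sup>2) summable_on W"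
          using g by (intro summable_on_cmult_right) (simp add: ell2_def)
        then have "(\<lambda>u. inverse ((cmod (g (w k)))\<^sup>2) * (cmod (g u))\<^sup>2) summable_on (\<Union>m. block k m)"
          by (rule summable_on_subset_banach) (use block_subset[OF k] in blast)
        also have "?this \<longleftrightarrow> (\<lambda>u. (ratio (w k) u)\<^sup>2) summable_on (\<Union>m. block k m)"
          using nz
          by (intro summable_on_cong)
            (auto simp: range_function_eq_ratio[OF range k] norm_mult power_mult_distrib)
        also have "\<dots> \<longleftrightarrow> (\<lambda>u. (ratio (w k) u)\<^sup>2) summable_on W"
          unfolding UN_block[OF k] by (intro summable_on_cong_neutral) (auto simp: ratio_def)
        finally show False using diverge k by blast
      qed
      then show ?thesis
        using range_function_eq_ratio[OF range k v] by simp
    qed (use g in \<open>simp add: ell2_def\<close>)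
  qed
  \<comment> \<open>Analyticity asks for equality with the zero space, so the zero function must be
    shown to lie in every range.\<close>
  moreover have "(\<lambda>v. 0) \<in> (?S ^^ n) ` ell2 W" for n
  proof -
    have "?S (\<lambda>v. 0) = (\<lambda>v. 0)" by (simp add: weighted_shift_def fun_eq_iff)
    then have "(?S ^^ n) (\<lambda>v. 0) = (\<lambda>v. 0)" by (induction n) simp_all
    moreover have "(\<lambda>v. 0) \<in> ell2 W" by (simp add: ell2_def)
    ultimately show ?thesis by (metis image_eqI)
  qed
  ultimately show "analytic_ell2 W ?S"
    unfolding analytic_ell2_def by blast
qed

end

theorem theorem2p1:
  fixes W V :: "'a set" and F E :: "('a \<times> 'a) set" and rt :: 'a
    and l :: nat and w :: "nat \<Rightarrow> 'a" and lam :: "'a \<Rightarrow> real"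
  assumes "one_circuit_digraph W F V E rt l w"
    and "locally_finite V E"
    and "countable W" and "infinite W"
    and "leafless W F"
    and "\<And>v. v \<in> W \<Longrightarrow> lam v > 0"
    and "(INF v\<in>W. lam v) > 0"
    and "bounded_operator_ell2 W (weighted_shift W F lam)"
  shows "analytic_ell2 W (weighted_shift W F lam) \<longleftrightarrow>
    (\<forall>k\<in>{1..l + 1}. \<not> summable (\<lambda>m::nat.
       if m = 0 then
         (\<Sum>v\<in>Chi_iter W F k rt.
            (weight_pow W F lam k v / weight_pow W F lam k (w k))\<^sup>2)
       else
         (\<Sum>v\<in>Chi_iter V E ((l + 1) * m + k) rt.
            (weight_pow W F lam ((l + 1) * m + k) v /
             weight_pow W F lam ((l + 1) * m + k) (w k))\<^sup>2)))"
proof -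
  interpret one_circuit W V F E rt l w lam
    using assms(1,6) by unfold_locales
  have "weighted_shift W F lam f \<in> ell2 W" if "f \<in> ell2 W" for f
    using assms(8) that by (simp add: bounded_operator_ell2_def)
  from analytic_ell2_iff[OF this] summable_series_iff[OF _ assms(2)] show ?thesis
    by auto
qed

end
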